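(* The monogenic free regular $\star$-monoid $\mathbf{F}_1^\star$ has intermediate growth.
   Context: Let $\{a\}$ be a one-letter alphabet and $a^\star$ a further letter. Define the involution $w\mapsto w^\star$ on the free monoid $\{a,a^\star\}^\ast$ by exchanging the letters $a$ and $a^\star$ and reversing the word, so that $(xy)^\star=y^\star x^\star$. The monogenic free regular $\star$-monoid $\mathbf{F}_1^\star$ is the monoid with generators $a, a^\star$ and defining relations $ww^\star w=w$ for all words $w\in\{a,a^\star\}^\ast$. If $M$ is a monoid generated by a finite set $A$, the length of $m\in M$ is the least $k$ such that $m$ can be written as a word of length $k$ over $A$; the ball of radius $k$ is the set of elements of length at most $k$; the growth function $\gamma$ maps $k\in\mathbb{N}$ to the number of elements in the ball of radius $k$. The growth rate is $\limsup_{n\to\infty}\gamma(n)^{1/n}$. $M$ has exponential growth if the growth rate is greater than $1$; it has polynomial growth if there are natural numbers $C,d$ such that $\gamma(n)\le (Cn)^d$ for all $n\ge 1$; it has intermediate growth if it has neither polynomial nor exponential growth. The growth of $\mathbf{F}_1^\star$ is taken with respect to the monoid generating set $\{a,a^\star\}$. *)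

theory Defs
  imports Complex_Main "HOL-Library.Extended_Real" "HOL-Library.Liminf_Limsup"
begin

definition generates :: "'m::monoid_mult set \<Rightarrow> bool" where
  "generates A \<longleftrightarrow> (\<forall>m. \<exists>w\<in>lists A. prod_list w = m)"

text \<open>The following notions are meaningful only if \<open>A\<close> is finite and \<open>generates A\<close> holds.\<close>

definition word_length :: "'m::monoid_mult set \<Rightarrow> 'm \<Rightarrow> nat" where
  "word_length A m = (LEAST k. \<exists>w\<in>lists A. length w = k \<and> prod_list w = m)"

definition growth_ball :: "'m::monoid_mult set \<Rightarrow> nat \<Rightarrow> 'm set" where
  "growth_ball A k = {m. word_length A m \<le> k}"

definition growth_fun :: "'m::monoid_mult set \<Rightarrow> nat \<Rightarrow> nat" where
  "growth_fun A k = card (growth_ball A k)"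

definition growth_rate :: "'m::monoid_mult set \<Rightarrow> ereal" where
  "growth_rate A = limsup (\<lambda>n. ereal (root n (real (growth_fun A n))))"

definition exponential_growth :: "'m::monoid_mult set \<Rightarrow> bool" where
  "exponential_growth A \<longleftrightarrow> growth_rate A > 1"

definition polynomial_growth :: "'m::monoid_mult set \<Rightarrow> bool" where
  "polynomial_growth A \<longleftrightarrow> (\<exists>C d :: nat. \<forall>n\<ge>1. growth_fun A n \<le> (C * n) ^ d)"

definition intermediate_growth :: "'m::monoid_mult set \<Rightarrow> bool" where
  "intermediate_growth A \<longleftrightarrow> \<not> polynomial_growth A \<and> \<not> exponential_growth A"

lemma finite_growth_ball:
  assumes "finite A" "generates A"
  shows "finite (growth_ball A k)"
proof -
  have "growth_ball A k \<subseteq> prod_list ` {w. set w \<subseteq> A \<and> length w \<le> k}"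
  proof
    fix m assume m: "m \<in> growth_ball A k"
    obtain w where "w \<in> lists A" "prod_list w = m"
      using assms(2) unfolding generates_def by blast
    then have "\<exists>n. \<exists>w\<in>lists A. length w = n \<and> prod_list w = m" by blast
    then have "\<exists>w\<in>lists A. length w = word_length A m \<and> prod_list w = m"
      unfolding word_length_def by (rule LeastI_ex)
    with m show "m \<in> prod_list ` {w. set w \<subseteq> A \<and> length w \<le> k}"
      unfolding growth_ball_def by (auto simp: in_lists_conv_set)
  qed
  then show ?thesis
    using finite_lists_length_le[OF assms(1)] by (meson finite_imageI finite_subset)
qed

datatype letter = La | La_star

fun letter_star :: "letter \<Rightarrow> letter" where
  "letter_star La = La_star"
| "letter_star La_star = La"

definition word_star :: "letter list \<Rightarrow> letter list" where
  "word_star w = rev (map letter_star w)"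

inductive F1_cong :: "letter list \<Rightarrow> letter list \<Rightarrow> bool" where
  rel: "F1_cong (w @ word_star w @ w) w"
| refl: "F1_cong u u"
| sym: "F1_cong u v \<Longrightarrow> F1_cong v u"
| trans: "F1_cong u v \<Longrightarrow> F1_cong v w \<Longrightarrow> F1_cong u w"
| append: "F1_cong u v \<Longrightarrow> F1_cong x y \<Longrightarrow> F1_cong (u @ x) (v @ y)"

quotient_type F1 = "letter list" / F1_cong
proof (rule equivpI)
  show "reflp F1_cong" by (rule reflpI) (rule F1_cong.refl)
  show "symp F1_cong" by (rule sympI) (rule F1_cong.sym)
  show "transp F1_cong" by (rule transpI) (rule F1_cong.trans)
qed

instantiation F1 :: monoid_mult
begin

lift_definition one_F1 :: F1 is "[]" .

lift_definition times_F1 :: "F1 \<Rightarrow> F1 \<Rightarrow> F1" is "(@)"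
  by (rule F1_cong.append)

instance
  by standard (transfer; simp add: F1_cong.refl)+

end

lift_definition F1_gen :: "letter \<Rightarrow> F1" is "\<lambda>x. [x]" .

definition F1_gens :: "F1 set" where
  "F1_gens = {F1_gen La, F1_gen La_star}"

lemma prod_list_F1_gen: "prod_list (map F1_gen w) = abs_F1 w"
  by (induction w) (simp_all add: one_F1_def F1_gen.abs_eq times_F1.abs_eq)

lemma finite_F1_gens: "finite F1_gens"
  by (simp add: F1_gens_def)

lemma generates_F1_gens: "generates F1_gens"
proof -
  have "\<exists>w\<in>lists F1_gens. prod_list w = m" for m
  proof -
    obtain u where "m = abs_F1 u" by (metis Quotient_F1 Quotient_abs_rep)
    moreover have "F1_gen x \<in> F1_gens" for x
      by (cases x) (simp_all add: F1_gens_def)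
    ultimately show ?thesis
      by (intro bexI[of _ "map F1_gen u"]) (auto simp: prod_list_F1_gen)
  qed
  then show ?thesis unfolding generates_def by blast
qed

end

theory Submission
  imports Defs "HOL-Real_Asymp.Real_Asymp" "HOL-Library.Discrete_Functions"
begin


text \<open>
  Read a word over \<open>a\<close>, \<open>a\<^sup>\<star>\<close> as a walk on the integers, with \<open>a\<close> a step up and \<open>a\<^sup>\<star>\<close> a step down.
  Then \<open>w\<^sup>\<star>\<close> is the walk \<open>w\<close> traversed backwards. Both halves of the proof use this picture.

  \<^bold>\<open>More than polynomial growth.\<close> After \<open>w\<close> has been walked, continuing with \<open>w\<^sup>\<star>w\<close> only revisits
  known integers and ends at the same point. Hence the order in which a walk discovers integers is
  the same for congruent words (\<open>F1_cong_explore\<close>). The integers discovered so far form an interval, and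
  each new one extends it either upwards or downwards. For every sequence of \<open>m\<close> such choices there
  is a walk that makes them, and since crossing the interval takes at most \<open>m\<close> steps each time, it has length
  at most \<open>m\<^sup>2\<close>. So \<open>\<gamma>(m\<^sup>2) \<ge> 2\<^sup>m\<close> (\<open>growth_fun_lower\<close>).

  \<^bold>\<open>Less than exponential growth.\<close> Every element is represented by a shortest word. Cut such a
  word into maximal runs of one letter, of lengths \<open>n\<^sub>0, n\<^sub>1, \<dots>\<close>. If an inner run of length \<open>q\<close>
  were no longer than both of its neighbours, the relation for the power \<open>a\<^sup>q\<close> or its star
  would shorten the word. So each inner run is longer than one of its neighbours, and an
  induction gives that a run with at least \<open>v\<close> others on both sides is longer than \<open>v\<close>
  (\<open>geodesic_runs_lower\<close>). Hence \<open>k\<close> runs need a length quadratic in \<open>k\<close>, a shortest word of length at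
  most \<open>n\<close> has \<open>O(\<surd>n)\<close> runs, and \<open>\<gamma>(n)\<close> is at most \<open>n\<close> to a power \<open>O(\<surd>n)\<close> (\<open>growth_fun_upper\<close>), whose
  \<open>n\<close>-th root tends to 1.
\<close>

section \<open>Length and balls in terms of words over the letters\<close>

lemma F1_gens_eq_range: "F1_gens = range F1_gen"
proof -
  have "(UNIV :: letter set) = {La, La_star}"
    using letter.exhaust by auto
  then have "range F1_gen = F1_gen ` {La, La_star}"
    by (rule arg_cong)
  then show ?thesis
    by (simp add: F1_gens_def)
qed

lemma mem_growth_ball_iff:
  "m \<in> growth_ball F1_gens k \<longleftrightarrow> (\<exists>u. abs_F1 u = m \<and> length u \<le> k)"
proof -
  have lists: "lists F1_gens = range (map F1_gen)"
    by (simp add: F1_gens_eq_range lists_image)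
  have words: "(\<exists>w\<in>lists F1_gens. length w = j \<and> prod_list w = m) \<longleftrightarrow> (\<exists>u. abs_F1 u = m \<and> length u = j)" for j
    unfolding lists by (auto simp: prod_list_F1_gen)
  have "\<exists>j u. abs_F1 u = m \<and> length u = j"
    by (metis Quotient_F1 Quotient_abs_rep)
  then have "\<exists>u. abs_F1 u = m \<and> length u = word_length F1_gens m"
    unfolding word_length_def words by (rule LeastI_ex)
  moreover have "word_length F1_gens m \<le> length u" if "abs_F1 u = m" for u
    unfolding word_length_def words using that by (intro Least_le) blast
  ultimately show ?thesis
    unfolding growth_ball_def by (auto intro: order_trans)
qed

lemma F1_eq_iff_cong: "abs_F1 u = abs_F1 v \<longleftrightarrow> F1_cong u v"
  by (simp add: F1.abs_eq_iff)

section \<open>The order of first visits is an invariant\<close>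

fun displacement :: "letter \<Rightarrow> int" where
  "displacement La = 1"
| "displacement La_star = - 1"

definition height :: "letter list \<Rightarrow> int" where
  "height w = sum_list (map displacement w)"

fun walk :: "int \<Rightarrow> letter list \<Rightarrow> int list" where
  "walk p [] = [p]"
| "walk p (x # w) = p # walk (p + displacement x) w"

text \<open>\<open>V\<close> lists the integers already discovered, the latest first; \<open>List.insert\<close> leaves it unchanged when
  the walk revisits one of them. Thus \<open>explore p w []\<close> records the order of first visits, while an
  arbitrary \<open>V\<close> makes the notion compositional.\<close>

definition explore :: "int \<Rightarrow> letter list \<Rightarrow> int list \<Rightarrow> int list" where
  "explore p w V = fold List.insert (walk p w) V"

lemma explore_Nil: "explore p [] V = List.insert p V"
  by (simp add: explore_def)

lemma explore_Cons: "explore p (x # w) V = explore (p + displacement x) w (List.insert p V)"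
  by (simp add: explore_def)

lemma height_simps [simp]:
  "height [] = 0" "height (x # w) = displacement x + height w" "height (u @ v) = height u + height v"
  by (simp_all add: height_def)

lemma displacement_star [simp]: "displacement (letter_star x) = - displacement x"
  by (cases x) simp_all

lemma word_star_simps [simp]:
  "word_star [] = []" "word_star (x # w) = word_star w @ [letter_star x]"
  by (simp_all add: word_star_def)

lemma height_word_star [simp]: "height (word_star w) = - height w"
  by (induction w) simp_all

lemma start_in_walk: "p \<in> set (walk p w)"
  by (cases w) simp_all

lemma set_walk_append:
  "set (walk p (u @ v)) = set (walk p u) \<union> set (walk (p + height u) v)"
  by (induction u arbitrary: p) (auto simp: start_in_walk algebra_simps)

text \<open>The walk along \<open>w\<^sup>\<star>\<close> from the endpoint of \<open>w\<close> is the walk along \<open>w\<close> in reverse order.\<close>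

lemma set_walk_star: "set (walk (p + height w) (word_star w)) = set (walk p w)"
proof (induction w arbitrary: p)
  case (Cons x w)
  show ?case
    using Cons[of "p + displacement x"] start_in_walk[of "p + displacement x" w]
    by (auto simp: set_walk_append algebra_simps)
qed simp

lemma set_fold_insert: "set (fold List.insert ys V) = set ys \<union> set V"
  by (induction ys arbitrary: V) auto

lemma fold_insert_absorb: "set ys \<subseteq> set V \<Longrightarrow> fold List.insert ys V = V"
  by (induction ys) auto

lemma explore_append: "explore p (u @ v) V = explore (p + height u) v (explore p u V)"
proof (induction u arbitrary: p V)
  case Nil
  show ?case
    by (cases v) (simp_all add: explore_def)
next
  case (Cons x u)
  then show ?case
    by (simp add: explore_Cons algebra_simps)
qed

lemma explore_star_cancel: "explore p (w @ word_star w @ w) V = explore p w V"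
proof -
  have "set (walk p w) \<subseteq> set (explore p w V)"
    by (simp add: explore_def set_fold_insert)
  then have "explore (p + height w) (word_star w) (explore p w V) = explore p w V"
       and "explore p w (explore p w V) = explore p w V"
    unfolding explore_def[of "p + height w"] explore_def[of p w "explore p w V"]
    by (intro fold_insert_absorb; simp add: set_walk_star)+
  then show ?thesis
    by (simp add: explore_append)
qed

text \<open>The invariant is stated for all starting points and all histories because this is what makes it
  compatible with concatenation; the endpoint has to be carried along to know where the second
  factor starts.\<close>

lemma F1_cong_explore:
  assumes "F1_cong u v"
  shows "height u = height v \<and> (\<forall>p V. explore p u V = explore p v V)"
  using assms
proof induction
  case (rel w)
  then show ?case
    using explore_star_cancel by simp
qed (simp_all add: explore_append)

section \<open>Every pattern of left and right exploration occurs\<close>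

text \<open>With \<open>{lo..hi}\<close> already visited, \<open>True\<close> stands for discovering the integer just above this interval
  and \<open>False\<close> for the one just below; \<open>sweep\<close> is the shortest walk from \<open>p\<close> that makes the given choices.\<close>

fun discovered :: "int \<Rightarrow> int \<Rightarrow> bool list \<Rightarrow> int list" where
  "discovered lo hi [] = []"
| "discovered lo hi (True # s) = (hi + 1) # discovered lo (hi + 1) s"
| "discovered lo hi (False # s) = (lo - 1) # discovered (lo - 1) hi s"

fun sweep :: "int \<Rightarrow> int \<Rightarrow> int \<Rightarrow> bool list \<Rightarrow> letter list" where
  "sweep lo hi p [] = []"
| "sweep lo hi p (True # s) = replicate (nat (hi + 1 - p)) La @ sweep lo (hi + 1) (hi + 1) s"
| "sweep lo hi p (False # s) = replicate (nat (p - (lo - 1))) La_star @ sweep (lo - 1) hi (lo - 1) s"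

lemma discovered_inject:
  "lo \<le> hi \<Longrightarrow> discovered lo hi s = discovered lo hi t \<Longrightarrow> s = t"
proof (induction lo hi s arbitrary: t rule: discovered.induct)
  case (1 lo hi)
  then show ?case
    by (cases "(lo, hi, t)" rule: discovered.cases) auto
next
  case (2 lo hi s)
  then show ?case
    by (cases "(lo, hi, t)" rule: discovered.cases) auto
next
  case (3 lo hi s)
  then show ?case
    by (cases "(lo, hi, t)" rule: discovered.cases) auto
qed

lemma height_replicate: "height (replicate n x) = int n * displacement x"
  by (induction n) (simp_all add: algebra_simps)

lemma explore_run_up:
  assumes "set V = {lo..hi}" "lo \<le> p" "p \<le> hi"
  shows "explore p (replicate (nat (hi + 1 - p)) La) V = (hi + 1) # V"
proof -
  have "explore p (replicate (Suc n) La) V = (p + int n + 1) # V" if "lo \<le> p" "p + int n = hi" for n p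
    using that
  proof (induction n arbitrary: p)
    case 0
    then show ?case
      using assms(1) by (simp add: explore_Cons explore_Nil List.insert_def)
  next
    case (Suc n)
    have "List.insert p V = V"
      using Suc.prems assms(1) by (simp add: List.insert_def)
    then show ?case
      using Suc.IH[of "p + 1"] Suc.prems by (simp add: explore_Cons add.commute add.left_commute)
  qed
  from this[of p "nat (hi - p)"] assms(2,3) show ?thesis
    by (simp add: Suc_nat_eq_nat_zadd1 algebra_simps del: replicate_Suc)
qed

lemma explore_run_down:
  assumes "set V = {lo..hi}" "lo \<le> p" "p \<le> hi"
  shows "explore p (replicate (nat (p - (lo - 1))) La_star) V = (lo - 1) # V"
proof -
  have "explore p (replicate (Suc n) La_star) V = (p - int n - 1) # V" if "p \<le> hi" "p - int n = lo" for n p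
    using that
  proof (induction n arbitrary: p)
    case 0
    then show ?case
      using assms(1) by (simp add: explore_Cons explore_Nil List.insert_def)
  next
    case (Suc n)
    have "List.insert p V = V"
      using Suc.prems assms(1) by (simp add: List.insert_def)
    then show ?case
      using Suc.IH[of "p - 1"] Suc.prems by (simp add: explore_Cons algebra_simps)
  qed
  from this[of p "nat (p - lo)"] assms(2,3) show ?thesis
    by (simp add: Suc_nat_eq_nat_zadd1 algebra_simps del: replicate_Suc)
qed

lemma explore_sweep:
  assumes "set V = {lo..hi}" "lo \<le> p" "p \<le> hi"
  shows "explore p (sweep lo hi p s) V = rev (discovered lo hi s) @ V"
  using assms
proof (induction lo hi p s arbitrary: V rule: sweep.induct)
  case (1 lo hi p)
  then show ?case
    by (simp add: explore_Nil List.insert_def)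
next
  case (2 lo hi p s)
  have "set ((hi + 1) # V) = {lo..hi + 1}"
    using "2.prems" by auto
  with 2 show ?case
    by (simp add: explore_append height_replicate explore_run_up)
next
  case (3 lo hi p s)
  have "set ((lo - 1) # V) = {lo - 1..hi}"
    using "3.prems" by auto
  with 3 show ?case
    by (simp add: explore_append height_replicate explore_run_down)
qed

text \<open>Each of the \<open>length s\<close> parts of the walk crosses at most the whole interval, whose final diameter
  is \<open>hi - lo + length s\<close>.\<close>

lemma length_sweep:
  "lo \<le> p \<Longrightarrow> p \<le> hi \<Longrightarrow> int (length (sweep lo hi p s)) \<le> int (length s) * (hi - lo + int (length s))"
proof (induction lo hi p s rule: sweep.induct)
  case (2 lo hi p s)
  then show ?case
    by (simp add: algebra_simps)
next
  case (3 lo hi p s)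
  then show ?case
    by (simp add: algebra_simps)
qed simp

text \<open>Different exploration patterns give walks that discover the integers in different orders, hence
  different elements.\<close>

lemma growth_fun_lower: "2 ^ m \<le> growth_fun F1_gens (m\<^sup>2)"
proof -
  let ?S = "{s :: bool list. length s = m}"
  let ?f = "\<lambda>s. abs_F1 (sweep 0 0 0 s)"
  have "inj_on ?f ?S"
  proof (rule inj_onI)
    fix s t
    assume "?f s = ?f t"
    then have "explore 0 (sweep 0 0 0 s) [0] = explore 0 (sweep 0 0 0 t) [0]"
      using F1_cong_explore F1_eq_iff_cong by blast
    then show "s = t"
      by (auto simp: explore_sweep intro: discovered_inject)
  qed
  moreover have "?f ` ?S \<subseteq> growth_ball F1_gens (m\<^sup>2)"
  proof clarify
    fix s :: "bool list"
    assume m: "m = length s"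
    have "int (length (sweep 0 0 0 s)) \<le> int ((length s)\<^sup>2)"
      using length_sweep[of 0 0 0 s] by (simp add: power2_eq_square)
    then show "?f s \<in> growth_ball F1_gens ((length s)\<^sup>2)"
      unfolding mem_growth_ball_iff by (metis of_nat_le_iff)
  qed
  ultimately have "card ?S \<le> growth_fun F1_gens (m\<^sup>2)"
    unfolding growth_fun_def
    by (rule card_inj_on_le) (rule finite_growth_ball[OF finite_F1_gens generates_F1_gens])
  moreover have "card ?S = 2 ^ m"
    using card_lists_length_eq[of "UNIV :: bool set" m] by simp
  ultimately show ?thesis
    by simp
qed

text \<open>Along the squares, a polynomial bound would give \<open>2\<^sup>m \<le> (C m\<^sup>2)\<^sup>d\<close> for all \<open>m\<close>.\<close>

lemma not_polynomial_growth_F1: "\<not> polynomial_growth F1_gens"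
proof
  assume "polynomial_growth F1_gens"
  then obtain C d where poly: "\<And>n. n \<ge> 1 \<Longrightarrow> growth_fun F1_gens n \<le> (C * n) ^ d"
    unfolding polynomial_growth_def by blast
  have "(\<lambda>m. real C ^ d * (real m ^ (2 * d) / 2 ^ m)) \<longlonglongrightarrow> real C ^ d * 0"
    by (intro tendsto_mult_left) real_asymp
  from order_tendstoD(2)[OF this, of 1] have "\<forall>\<^sub>F m in sequentially. real C ^ d * (real m ^ (2 * d) / 2 ^ m) < 1"
    by simp
  then obtain m where m: "m \<ge> 1" "real C ^ d * (real m ^ (2 * d) / 2 ^ m) < 1"
    using eventually_happens'[OF sequentially_bot eventually_conj[OF eventually_ge_at_top[of 1]]]
    by blast
  have "2 ^ m \<le> (C * m\<^sup>2) ^ d"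
    using growth_fun_lower[of m] poly[of "m\<^sup>2"] m(1) by (simp add: order_trans)
  then have "real (2 ^ m) \<le> real ((C * m\<^sup>2) ^ d)"
    by (rule of_nat_mono)
  then show False
    using m(2) by (simp add: power_mult_distrib field_simps flip: power_mult)
qed

section \<open>Geodesic words have few runs\<close>

text \<open>The letters of consecutive runs alternate. Runs of length 0 are admitted, so that lists can be padded
  to a common length when words are counted; for positive entries the runs are the maximal ones.\<close>

fun runs :: "letter \<Rightarrow> nat list \<Rightarrow> letter list" where
  "runs x [] = []"
| "runs x (n # ns) = replicate n x @ runs (letter_star x) ns"

lemma letter_star_involution [simp]: "letter_star (letter_star x) = x"
  by (cases x) simp_all

lemma runs_append:
  "runs x (ms @ ns) = runs x ms @ runs ((letter_star ^^ length ms) x) ns"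
  by (induction ms arbitrary: x) (simp_all add: funpow_swap1)

lemma runs_zeros: "runs x (replicate k 0) = []"
  by (induction k arbitrary: x) simp_all

lemma length_runs: "length (runs x ns) = sum_list ns"
  by (induction ns arbitrary: x) simp_all

lemma word_as_runs: "\<exists>x ns. w = runs x ns \<and> 0 \<notin> set ns"
proof (induction w)
  case Nil
  have "[] = runs La []" by simp
  then show ?case by fastforce
next
  case (Cons y w)
  then obtain x ns where w: "w = runs x ns" "0 \<notin> set ns"
    by blast
  show ?case
  proof (cases ns)
    case Nil
    with w have "y # w = runs y [1]" by simp
    then show ?thesis by fastforce
  next
    case (Cons n ms)
    show ?thesis
    proof (cases "y = x")
      case True
      with w Cons have "y # w = runs x (Suc n # ms)" by simp
      with w Cons show ?thesis by fastforce
    next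
      case False
      then have "x = letter_star y"
        by (cases x; cases y) simp_all
      with w have "y # w = runs y (1 # ns)" by simp
      with w show ?thesis by fastforce
    qed
  qed
qed

definition geodesic :: "letter list \<Rightarrow> bool" where
  "geodesic u \<longleftrightarrow> (\<forall>v. F1_cong u v \<longrightarrow> length u \<le> length v)"

lemma word_star_replicate: "word_star (replicate n x) = replicate n (letter_star x)"
  by (simp add: word_star_def)

text \<open>Here \<open>w\<close> is the power \<open>x\<^sup>q\<close>: the outer runs split as \<open>x\<^sup>p\<^sup>-\<^sup>q w\<close> and \<open>w x\<^sup>r\<^sup>-\<^sup>q\<close>, so \<open>w w\<^sup>\<star> w\<close> appears in the middle.\<close>

lemma F1_cong_short_middle_run:
  assumes "q \<le> p" "q \<le> r"
  shows "F1_cong (replicate p x @ replicate q (letter_star x) @ replicate r x)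
                 (replicate (p + r - q) x)"
proof -
  let ?w = "replicate q x"
  have "F1_cong (replicate (p - q) x @ (?w @ word_star ?w @ ?w) @ replicate (r - q) x)
                (replicate (p - q) x @ ?w @ replicate (r - q) x)"
    by (intro F1_cong.append F1_cong.refl F1_cong.rel)
  moreover have "replicate p x = replicate (p - q) x @ ?w"
    using assms(1) by (simp flip: replicate_add)
  moreover have "replicate r x = ?w @ replicate (r - q) x"
    using assms(2) by (simp flip: replicate_add)
  moreover have "replicate (p + r - q) x = replicate (p - q) x @ ?w @ replicate (r - q) x"
    using assms by (simp flip: replicate_add)
  ultimately show ?thesis
    by (simp add: word_star_replicate)
qed

text \<open>Otherwise the three runs merge into one, which saves \<open>2q\<close> letters.\<close>

lemma geodesic_no_local_min:
  assumes geo: "geodesic (runs x (ms @ p # q # r # ns))" and "0 < q"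
  shows "min p r < q"
proof (rule ccontr)
  assume "\<not> min p r < q"
  then have q: "q \<le> p" "q \<le> r" by auto
  let ?y = "(letter_star ^^ length ms) x"
  let ?v = "runs x ms @ replicate (p + r - q) ?y @ runs (letter_star ?y) ns"
  have "F1_cong (runs x ms @ (replicate p ?y @ replicate q (letter_star ?y) @ replicate r ?y)
           @ runs (letter_star ?y) ns) ?v"
    using q by (intro F1_cong.append F1_cong.refl F1_cong_short_middle_run)
  then have "F1_cong (runs x (ms @ p # q # r # ns)) ?v"
    by (simp add: runs_append)
  with geo have "length (runs x (ms @ p # q # r # ns)) \<le> length ?v"
    unfolding geodesic_def by blast
  with q \<open>0 < q\<close> show False
    by (simp add: length_runs)
qed

text \<open>Induction on \<open>v\<close>: a run with \<open>v + 1\<close> runs on either side has two neighbours with at least \<open>v\<close> runs on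
  either side, hence of length above \<open>v\<close>, and it is longer than one of them.\<close>

lemma geodesic_runs_lower:
  assumes geo: "geodesic (runs x ns)" and pos: "0 \<notin> set ns"
  shows "v \<le> i \<Longrightarrow> i + v < length ns \<Longrightarrow> v < ns ! i"
proof (induction v arbitrary: i)
  case 0
  then show ?case
    using pos by (metis add.right_neutral gr0I nth_mem)
next
  case (Suc v)
  then obtain j where j: "i = Suc j"
    by (cases i) auto
  have "ns = take j ns @ ns ! j # ns ! Suc j # ns ! Suc (Suc j) # drop (Suc (Suc (Suc j))) ns"
    using Suc.prems j by (simp add: Cons_nth_drop_Suc)
  moreover have "0 < ns ! Suc j"
    using pos Suc.prems j by (metis add_lessD1 gr0I nth_mem)
  ultimately have "min (ns ! j) (ns ! Suc (Suc j)) < ns ! Suc j"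
    using geo geodesic_no_local_min by metis
  moreover have "v < ns ! j" "v < ns ! Suc (Suc j)"
    using Suc.prems j by (auto intro: Suc.IH)
  ultimately show ?case
    using j by simp
qed

text \<open>Among \<open>3v\<close> or more runs, the \<open>v\<close> runs with indices from \<open>v\<close> to \<open>2v - 1\<close> have at least \<open>v\<close> runs
  on either side, and so they alone have total length at least \<open>v\<^sup>2\<close>.\<close>

lemma geodesic_few_runs:
  assumes geo: "geodesic (runs x ns)" and pos: "0 \<notin> set ns" and short: "sum_list ns < v\<^sup>2"
  shows "length ns < 3 * v"
proof (rule ccontr)
  assume "\<not> length ns < 3 * v"
  then have long: "3 * v \<le> length ns" by simp
  have "v\<^sup>2 = (\<Sum>i\<in>{v..<2 * v}. v)"
    by (simp add: power2_eq_square)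
  also have "\<dots> \<le> (\<Sum>i\<in>{v..<2 * v}. ns ! i)"
    using long by (intro sum_mono order.strict_implies_order[OF geodesic_runs_lower[OF geo pos]]) auto
  also have "\<dots> \<le> (\<Sum>i\<in>{0..<length ns}. ns ! i)"
    using long by (intro sum_mono2) auto
  also have "\<dots> = sum_list ns"
    by (simp add: sum_list_sum_nth)
  finally show False
    using short by simp
qed

section \<open>Counting geodesics\<close>

text \<open>A shortest word is determined by its first letter and its fewer than \<open>3v\<close> run lengths, each at most \<open>n\<close>;
  padding with zeros turns these into lists of length exactly \<open>3v\<close>.\<close>

lemma growth_fun_upper:
  assumes "n < v\<^sup>2"
  shows "growth_fun F1_gens n \<le> 2 * (n + 1) ^ (3 * v)"
proof -
  let ?L = "{ns. set ns \<subseteq> {0..n} \<and> length ns = 3 * v}"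
  let ?f = "\<lambda>(x, ns). abs_F1 (runs x ns)"
  have fin: "finite ?L"
    by (rule finite_lists_length_eq) simp
  have "growth_ball F1_gens n \<subseteq> ?f ` ({La, La_star} \<times> ?L)"
  proof
    fix m
    assume "m \<in> growth_ball F1_gens n"
    then obtain u\<^sub>0 where u0: "abs_F1 u\<^sub>0 = m" "length u\<^sub>0 \<le> n"
      unfolding mem_growth_ball_iff by blast
    then obtain u where u: "abs_F1 u = m" "\<And>v. abs_F1 v = m \<Longrightarrow> length u \<le> length v"
      using ex_has_least_nat[of "\<lambda>u. abs_F1 u = m" u\<^sub>0 length] by blast
    obtain x ns where ns: "u = runs x ns" "0 \<notin> set ns"
      using word_as_runs by blast
    have "geodesic (runs x ns)"
      unfolding geodesic_def using u ns F1_eq_iff_cong by metis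
    moreover have sum: "sum_list ns \<le> n"
      using u(2)[OF u0(1)] u0(2) by (simp add: ns(1) length_runs)
    ultimately have len: "length ns < 3 * v"
      using geodesic_few_runs ns(2) assms by simp
    have "set ns \<subseteq> {0..n}"
      using sum member_le_sum_list[of _ ns] by fastforce
    with len have "ns @ replicate (3 * v - length ns) 0 \<in> ?L"
      by auto
    moreover have "m = ?f (x, ns @ replicate (3 * v - length ns) 0)"
      using u(1) ns(1) by (simp add: runs_append runs_zeros)
    moreover have "x \<in> {La, La_star}"
      by (cases x) simp_all
    ultimately show "m \<in> ?f ` ({La, La_star} \<times> ?L)"
      by blast
  qed
  then have "growth_fun F1_gens n \<le> card ({La, La_star} \<times> ?L)"
    unfolding growth_fun_def
    by (rule surj_card_le[rotated]) (use fin in simp)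
  also have "\<dots> = 2 * (n + 1) ^ (3 * v)"
    by (simp add: card_cartesian_product card_lists_length_eq)
  finally show ?thesis .
qed

text \<open>Taking for \<open>v\<close> the least number whose square exceeds \<open>n\<close> gives the bound
  \<open>2 (n + 1)\<^bsup>3(\<surd>n + 1)\<^esup>\<close>, whose logarithm is \<open>o(n)\<close>.\<close>

lemma not_exponential_growth_F1: "\<not> exponential_growth F1_gens"
proof -
  define g :: "nat \<Rightarrow> real"
    where "g n = (2 * (real n + 1) powr (3 * (sqrt n + 1))) powr (1 / real n)" for n
  have bound: "root n (real (growth_fun F1_gens n)) \<le> g n" if "0 < n" for n
  proof -
    define v where "v = Suc (floor_sqrt n)"
    have "n < v\<^sup>2"
      unfolding v_def by (rule Suc_floor_sqrt_power2_gt)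
    then have "real (growth_fun F1_gens n) \<le> real (2 * (n + 1) ^ (3 * v))"
      using growth_fun_upper of_nat_mono by blast
    also have "\<dots> = 2 * (real n + 1) powr (3 * real v)"
      by (simp add: powr_realpow[symmetric] add.commute)
    also have "\<dots> \<le> 2 * (real n + 1) powr (3 * (sqrt n + 1))"
    proof -
      have "real (floor_sqrt n) \<le> sqrt n"
        using floor_sqrt_power2_le[of n] by (intro real_le_rsqrt) (metis of_nat_le_iff of_nat_power)
      then show ?thesis
        unfolding v_def by (intro mult_left_mono powr_mono) auto
    qed
    finally have "root n (real (growth_fun F1_gens n)) \<le> root n (2 * (real n + 1) powr (3 * (sqrt n + 1)))"
      using that by simp
    also have "\<dots> = g n"
      unfolding g_def using that by (subst root_powr_inverse) auto
    finally show ?thesis .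
  qed
  have "g \<longlonglongrightarrow> 1"
    unfolding g_def by real_asymp
  then have "limsup (\<lambda>n. ereal (g n)) = 1"
    by (intro lim_imp_Limsup) (simp_all add: one_ereal_def)
  moreover have "growth_rate F1_gens \<le> limsup (\<lambda>n. ereal (g n))"
    unfolding growth_rate_def
    by (intro Limsup_mono eventually_mono[OF eventually_gt_at_top[of 0]]) (simp add: bound)
  ultimately show ?thesis
    by (simp add: exponential_growth_def not_less)
qed

theorem theorem1:
  "intermediate_growth F1_gens"
  by (simp add: intermediate_growth_def not_polynomial_growth_F1 not_exponential_growth_F1)

end
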